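(* Let $\{z^t\}$ be the sequence of SQG-estimates at a point $x\in X$. Assume that (i) for all $t$ the tracked densities $g^t$ belong to $G$ and $|g^{t+1}(x)-g^t(x)|\le \delta(x)$, where $\delta(x)>0$; (ii) the kernel $K$ is a bounded Borel density with $\int_X K(y)\,dy=1$, $\sup_{y\in X} K(y)\le\overline K$, and $A=\int_{\mathbb{R}^r}\|y\|^{\nu}K(y)\,dy<+\infty$; (iii) the adjustment coefficients and window parameters are constant: $\rho_t\equiv\rho$ with $0<\rho\le 1/2$, and $\theta_t\equiv\theta$. Then at any point $x$ where all densities $g^t$ are globally Hölder continuous (with constants $H=H(x)$, $\nu=\nu(x)>0$), the tracking error satisfies, for every $t\ge0$, $$(z^{t+1}-g^{t+1}(x))^2\le 4\overline g\,\delta(x)\rho^{-1}+2\overline g AH\theta^{\nu}+\overline g^{2}\rho+\overline K^{2}\rho\theta^{-2r}+(1-2\rho)^t(z^0-g^0(x))^2+\zeta_t,$$ where the stochastic term $\zeta_t$ has zero mean $\mathbf{E}\zeta_t=0$ and variance $D\zeta_t\le 2\rho\,\overline g^{3}(\overline g+\overline K\theta^{-r})$.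
   Context: Let $X\subseteq\mathbb{R}^r$. $G$ is the class of functions $g$ on $X$ with $0\le\underline g(x)\le g(x)\le\overline g(x)\le\overline g$ for all $x\in X$, where $\underline g(\cdot),\overline g(\cdot)$ are given functions and $\overline g$ is a finite constant. For $t=0,1,\dots$, $g^t$ is a probability density on $X$; the observations $\overline x_0,\overline x_1,\dots$ are independent random vectors on a probability space $(\Omega,\Sigma,P)$, $\overline x_t$ having density $g^t$. $K\ge0$ is a kernel and $\theta>0$ is the window size. Global Hölder continuity at $x$: there are $H=H(x)$ and $\nu=\nu(x)>0$, not depending on $t$, such that $|g^t(x)-g^t(y)|\le H\|x-y\|^{\nu}$ for all $y\in X$ and all $t$. SQG-estimates at $x$: given $z^0\in[\underline g(x),\overline g(x)]$, adjustment coefficients $\rho_t$ and window parameters $\theta_t$, $$z^{t+1}=\min\{\overline g(x),\max\{\underline g(x),\,z^t-\rho_t\xi_t\}\},\qquad \xi_t=z^t-\frac1{\theta_t^r}K\Big(\frac{\overline x_t-x}{\theta_t}\Big),\quad t=0,1,\dots$$ $\mathbf{E}$ and $D$ denote expectation and variance.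
   Formalization: Adds the hypothesis that the kernel centred at x with window θ has mass 1 on X, i.e. ∫_X θ^{-r}K((y-x)/θ)dy = 1 (automatic for X=R^r); without it the claim fails, e.g. X=[0,1], x=1, θ=1, K=1_{[0,1]}, g^t=1, with small ρ and δ. *)

theory Defs
  imports "HOL-Probability.Probability"
begin

text \<open>
  Functions on \<open>X\<close> are represented by total functions on \<open>real ^ 'r\<close>; their values
  outside \<open>X\<close> are never constrained and never used.
\<close>

definition tracked_class ::
    "(real ^ 'r) set \<Rightarrow> (real ^ 'r \<Rightarrow> real) \<Rightarrow> (real ^ 'r \<Rightarrow> real) \<Rightarrow> real
      \<Rightarrow> (real ^ 'r \<Rightarrow> real) set" where
  "tracked_class X glo gup gbar =
     {g. \<forall>x\<in>X. 0 \<le> glo x \<and> glo x \<le> g x \<and> g x \<le> gup x \<and> gup x \<le> gbar}"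

definition prob_density_on :: "(real ^ 'r) set \<Rightarrow> (real ^ 'r \<Rightarrow> real) \<Rightarrow> bool" where
  "prob_density_on X f \<longleftrightarrow>
     set_borel_measurable borel X f \<and> (\<forall>y\<in>X. 0 \<le> f y) \<and> (LINT y:X|lborel. f y) = 1"

definition globally_holder_at ::
    "(real ^ 'r) set \<Rightarrow> (nat \<Rightarrow> real ^ 'r \<Rightarrow> real) \<Rightarrow> real \<Rightarrow> real \<Rightarrow> real ^ 'r \<Rightarrow> bool" where
  "globally_holder_at X g H \<nu> x \<longleftrightarrow>
     \<nu> > 0 \<and> (\<forall>t. \<forall>y\<in>X. \<bar>g t x - g t y\<bar> \<le> H * norm (x - y) powr \<nu>)"

definition window_kernel :: "(real ^ 'r \<Rightarrow> real) \<Rightarrow> real \<Rightarrow> real ^ 'r \<Rightarrow> real ^ 'r \<Rightarrow> real" where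
  "window_kernel K \<theta> x y = K ((y - x) /\<^sub>R \<theta>) / \<theta> ^ CARD('r)"

text \<open>
  In \<open>sqg lo up K \<rho> \<theta> x z0 y\<close> the numbers \<open>lo\<close>, \<open>up\<close> are the projection bounds at the
  point \<open>x\<close>, and \<open>y\<close> is one realization of the observation sequence.
\<close>

primrec sqg ::
    "real \<Rightarrow> real \<Rightarrow> (real ^ 'r \<Rightarrow> real) \<Rightarrow> (nat \<Rightarrow> real) \<Rightarrow> (nat \<Rightarrow> real) \<Rightarrow> real ^ 'r \<Rightarrow> real
      \<Rightarrow> (nat \<Rightarrow> real ^ 'r) \<Rightarrow> nat \<Rightarrow> real" where
  "sqg lo up K \<rho> \<theta> x z0 y 0 = z0"
| "sqg lo up K \<rho> \<theta> x z0 y (Suc t) =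
     (let z = sqg lo up K \<rho> \<theta> x z0 y t; \<xi> = z - window_kernel K (\<theta> t) x (y t)
      in min up (max lo (z - \<rho> t * \<xi>)))"

end

theory Submission imports Defs begin

text \<open>
  Write \<open>e\<^sub>t = z\<^sup>t - g\<^sup>t(x)\<close> and \<open>w\<^sub>t\<close> for the kernel value at the \<open>t\<close>-th observation, with mean
  \<open>m\<^sub>t\<close>. Projection onto an interval containing \<open>g\<^sup>t(x)\<close> is nonexpansive, so
  \<open>e\<^sub>t\<^sup>2\<close> satisfies a linear recursion with contraction factor \<open>1 - 2\<rho>\<close>, a constant
  input (drift, the bias \<open>\<bar>m\<^sub>t - g\<^sup>t(x)\<bar> \<le> A H \<theta>\<^sup>\<nu>\<close>, second-order terms) and the noise
  \<open>2\<rho> e\<^sub>t (w\<^sub>t - m\<^sub>t)\<close>. Summing the geometric series gives the bound, with \<open>\<zeta>\<^sub>t\<close> the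
  discounted sum of the noise. As \<open>e\<^sub>t\<close> depends only on the observations before \<open>t\<close>, the noise
  terms are centred and pairwise orthogonal, and \<open>D w\<^sub>t \<le> sup w\<^sub>t * m\<^sub>t\<close> bounds the variance.
\<close>

lemma AE_lborel_affine:
  fixes x :: "'a::euclidean_space"
  assumes c: "c > 0" and [measurable]: "Measurable.pred borel P" and P: "AE u in lborel. P u"
  shows "AE y in lborel. P ((y - x) /\<^sub>R c)"
proof -
  have "AE y in density (distr lborel borel (\<lambda>u. x + c *\<^sub>R u)) (\<lambda>_. \<bar>c\<bar> ^ DIM('a)). P ((y - x) /\<^sub>R c)"
    using P c by (subst AE_density) (auto simp: AE_distr_iff)
  then show ?thesis
    using c by (subst lborel_affine[of c x]) auto
qed

text \<open>Change of variables \<open>y = x + c u\<close>. The divisor \<open>c ^ DIM('a)\<close>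
  cancels the Jacobian, and the integrand has the shape of \<open>window_kernel\<close>.\<close>

lemma
  fixes f :: "'a::euclidean_space \<Rightarrow> real" and x :: 'a
  assumes c: "c > 0" and [measurable]: "f \<in> borel_measurable borel"
  shows lborel_integrable_affine: "integrable lborel (\<lambda>y. f ((y - x) /\<^sub>R c) / c ^ DIM('a)) \<longleftrightarrow> integrable lborel f"
    and lborel_integral_affine: "(LINT y|lborel. f ((y - x) /\<^sub>R c) / c ^ DIM('a)) = (LINT u|lborel. f u)"
proof -
  let ?D = "density (distr lborel borel (\<lambda>u. x + c *\<^sub>R u)) (\<lambda>_. ennreal (c ^ DIM('a)))"
  let ?h = "\<lambda>y. f ((y - x) /\<^sub>R c) / c ^ DIM('a)"
  have D: "lborel = ?D"
    using lborel_affine[of c x] c by (simp add: ennreal_power)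
  have "integrable ?D ?h \<longleftrightarrow> integrable lborel f"
    using c by (subst integrable_density) (auto simp: integrable_distr_eq)
  then show "integrable lborel ?h \<longleftrightarrow> integrable lborel f"
    using D by simp
  have "(LINT y|?D. ?h y) = (LINT u|lborel. f u)"
    using c by (subst integral_density) (auto simp: integral_distr)
  then show "(LINT y|lborel. ?h y) = (LINT u|lborel. f u)"
    using D by simp
qed

text \<open>Nonnegativity and equal mass on \<open>X\<close> and on the whole space force
  \<open>K\<close> to vanish almost everywhere off \<open>X\<close>, and there \<open>C\<close> is a
  bound because it is nonnegative. In this way a supremum over \<open>X\<close> becomes a bound
  almost everywhere.\<close>

lemma AE_le_if_mass_on:
  fixes K :: "'a \<Rightarrow> real"
  assumes int: "integrable M K" and nonneg: "\<And>y. 0 \<le> K y"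
    and setint: "set_integrable M X K" and mass: "(LINT y:X|M. K y) = (LINT y|M. K y)"
    and le: "\<And>y. y \<in> X \<Longrightarrow> K y \<le> C" and C: "0 \<le> C"
  shows "AE y in M. K y \<le> C"
proof -
  have i2: "integrable M (\<lambda>y. indicat_real X y * K y)"
    using setint by (simp add: set_integrable_def)
  have "(LINT y|M. K y - indicat_real X y * K y) = 0"
    using int i2 mass by (simp add: set_lebesgue_integral_def)
  then have "AE y in M. K y - indicat_real X y * K y = 0"
    using int i2 nonneg
    by (subst (asm) integral_nonneg_eq_0_iff_AE) (auto simp: indicator_def)
  then show ?thesis
    by eventually_elim (use le C in \<open>auto simp: indicator_def split: if_splits\<close>)
qed

text \<open>Allows the full observation sequence to be replaced by its restriction to the past, from
  which independence of the present observation follows.\<close>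

lemma sqg_cong:
  assumes "\<And>s. s < t \<Longrightarrow> y s = y' s"
  shows "sqg lo up K \<rho> \<theta> x z0 y t = sqg lo up K \<rho> \<theta> x z0 y' t"
  using assms by (induction t) simp_all

lemma sqg_bounds:
  assumes "z0 \<in> {lo..up}"
  shows "lo \<le> sqg lo up K \<rho> \<theta> x z0 y t" "sqg lo up K \<rho> \<theta> x z0 y t \<le> up"
  using assms by (cases t; simp add: Let_def)+

lemma measurable_window_kernel [measurable]:
  assumes [measurable]: "K \<in> borel_measurable borel"
  shows "window_kernel K \<theta> x \<in> borel_measurable borel"
  unfolding window_kernel_def by measurable

text \<open>The product may have more coordinates than the estimate reads, so that estimates at
  several times become measurable functions on one common past.\<close>

lemma measurable_sqg:
  assumes [measurable]: "K \<in> borel_measurable borel" and "t \<le> T"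
  shows "(\<lambda>y. sqg lo up K \<rho> \<theta> x z0 y t) \<in> borel_measurable (PiM {..<T} (\<lambda>_. borel))"
  using \<open>t \<le> T\<close>
proof (induction t)
  case (Suc t)
  have [measurable]: "(\<lambda>y. sqg lo up K \<rho> \<theta> x z0 y t) \<in> borel_measurable (PiM {..<T} (\<lambda>_. borel))"
    using Suc by simp
  have [measurable]: "(\<lambda>y. y t) \<in> PiM {..<T} (\<lambda>_. borel) \<rightarrow>\<^sub>M borel"
    using Suc by simp
  show ?case
    by (simp add: Let_def)
qed simp

text \<open>As \<open>p\<close> lies in \<open>{lo..up}\<close>, projection does not increase the
  distance to \<open>p\<close>. The square is expanded with
  \<open>z - w = (z - p) - (m - p) - (w - m)\<close>, which separates contraction, bias and noise;
  the cross term of the square of \<open>z - w\<close> is dropped because both are nonnegative.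
  Moving the target from \<open>p\<close> to \<open>p'\<close> costs at most
  \<open>2 * G * \<delta>\<close>, by factoring a difference of squares. The noise term is kept
  exactly, since only its average is small.\<close>

lemma projected_step_bound:
  fixes z :: real
  assumes "lo \<le> z" "z \<le> up" "lo \<le> p" "p \<le> up" "lo \<le> p'" "p' \<le> up" "0 \<le> lo" "up \<le> G"
    and w: "0 \<le> w" "w \<le> \<kappa>" and bias: "\<bar>m - p\<bar> \<le> B" and drift: "\<bar>p' - p\<bar> \<le> \<delta>" and \<rho>: "0 \<le> \<rho>"
  shows "(min up (max lo (z - \<rho> * (z - w))) - p')\<^sup>2
    \<le> (1 - 2 * \<rho>) * (z - p)\<^sup>2 + (2 * \<rho> * (G * B) + \<rho>\<^sup>2 * (G\<^sup>2 + \<kappa>\<^sup>2) + 2 * G * \<delta>)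
      + 2 * \<rho> * ((z - p) * (w - m))"
proof -
  define v where "v = min up (max lo (z - \<rho> * (z - w)))"
  have v: "lo \<le> v" "v \<le> up"
    using assms unfolding v_def by auto
  have "\<bar>v - p\<bar> \<le> \<bar>z - \<rho> * (z - w) - p\<bar>"
    using assms unfolding v_def by linarith
  then have step: "(v - p)\<^sup>2 \<le> (z - \<rho> * (z - w) - p)\<^sup>2"
    by (simp only: abs_le_square_iff)
  have "(v - p')\<^sup>2 - (v - p)\<^sup>2 = (p' - p) * (p + p' - 2 * v)"
    by (simp add: power2_eq_square algebra_simps)
  also have "\<dots> \<le> \<bar>p' - p\<bar> * \<bar>p + p' - 2 * v\<bar>"
    by (metis abs_ge_self abs_mult)
  also have "\<dots> \<le> \<delta> * (2 * G)"
    using v assms by (intro mult_mono) auto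
  finally have shift: "(v - p')\<^sup>2 \<le> (v - p)\<^sup>2 + 2 * G * \<delta>"
    by (simp add: algebra_simps)
  have "(z - w)\<^sup>2 \<le> z\<^sup>2 + w\<^sup>2"
    using assms by (simp add: power2_diff)
  also have "\<dots> \<le> G\<^sup>2 + \<kappa>\<^sup>2"
    using assms by (intro add_mono power_mono) auto
  finally have "\<rho>\<^sup>2 * (z - w)\<^sup>2 \<le> \<rho>\<^sup>2 * (G\<^sup>2 + \<kappa>\<^sup>2)"
    by (intro mult_left_mono) auto
  moreover have "(z - p) * (m - p) \<le> G * B"
  proof -
    have "(z - p) * (m - p) \<le> \<bar>z - p\<bar> * \<bar>m - p\<bar>"
      by (metis abs_ge_self abs_mult)
    also have "\<dots> \<le> G * B"
      using assms by (intro mult_mono) auto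
    finally show ?thesis .
  qed
  then have "2 * \<rho> * ((z - p) * (m - p)) \<le> 2 * \<rho> * (G * B)"
    using \<rho> by (intro mult_left_mono) auto
  moreover have "(z - \<rho> * (z - w) - p)\<^sup>2 = (1 - 2 * \<rho>) * (z - p)\<^sup>2 + 2 * \<rho> * ((z - p) * (m - p))
      + 2 * \<rho> * ((z - p) * (w - m)) + \<rho>\<^sup>2 * (z - w)\<^sup>2"
    by (simp add: power2_eq_square algebra_simps)
  ultimately show ?thesis
    using step shift unfolding v_def by linarith
qed

lemma linear_recursion_le:
  fixes a :: "nat \<Rightarrow> real"
  assumes q: "0 \<le> q" and step: "\<And>t. a (Suc t) \<le> q * a t + c + d t"
  shows "a (Suc t) \<le> q ^ Suc t * a 0 + c * (\<Sum>j\<le>t. q ^ j) + (\<Sum>k\<le>t. q ^ (t - k) * d k)"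
proof (induction t)
  case 0
  show ?case using step[of 0] by simp
next
  case (Suc t)
  have "(\<Sum>j\<le>Suc t. q ^ j) = 1 + q * (\<Sum>j\<le>t. q ^ j)"
    by (subst sum.atMost_Suc_shift) (simp add: sum_distrib_left)
  moreover have "(\<Sum>k\<le>Suc t. q ^ (Suc t - k) * d k) = d (Suc t) + q * (\<Sum>k\<le>t. q ^ (t - k) * d k)"
    by (simp add: sum_distrib_left Suc_diff_le mult.assoc)
  ultimately show ?case
    using step[of "Suc t"] mult_left_mono[OF Suc q] by (simp add: algebra_simps)
qed

lemma sum_power_le:
  fixes q :: real
  assumes "0 \<le> q" "q < 1"
  shows "(\<Sum>i\<le>n. q ^ i) \<le> 1 / (1 - q)"
proof -
  have "(1 - q) * (\<Sum>i\<le>n. q ^ i) \<le> 1"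
    using assms by (simp add: sum_gp_basic)
  then show ?thesis
    using assms by (simp add: field_simps)
qed

text \<open>The index sets \<open>{..<k}\<close> and \<open>{k}\<close> are disjoint, so functions
  of the two groups of variables are independent and the expectation factorizes.\<close>

lemma (in prob_space) expectation_past_times_present:
  fixes F :: "(nat \<Rightarrow> 'b) \<Rightarrow> real" and h :: "'b \<Rightarrow> real"
  assumes indep: "indep_vars (\<lambda>_. N) X UNIV"
    and F: "F \<in> borel_measurable (PiM {..<k} (\<lambda>_. N))" and h [measurable]: "h \<in> borel_measurable N"
    and int: "integrable M (\<lambda>\<omega>. F (restrict (\<lambda>s. X s \<omega>) {..<k}))" "integrable M (\<lambda>\<omega>. h (X k \<omega>))"
  shows "expectation (\<lambda>\<omega>. F (restrict (\<lambda>s. X s \<omega>) {..<k}) * h (X k \<omega>))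
    = expectation (\<lambda>\<omega>. F (restrict (\<lambda>s. X s \<omega>) {..<k})) * expectation (\<lambda>\<omega>. h (X k \<omega>))"
proof -
  have "indep_var borel (F \<circ> (\<lambda>\<omega>. restrict (\<lambda>s. X s \<omega>) {..<k}))
      borel ((\<lambda>y. h (y k)) \<circ> (\<lambda>\<omega>. restrict (\<lambda>s. X s \<omega>) {k}))"
    using F by (intro indep_var_compose[OF indep_var_restrict[OF indep]]) auto
  then have "indep_var borel (\<lambda>\<omega>. F (restrict (\<lambda>s. X s \<omega>) {..<k})) borel (\<lambda>\<omega>. h (X k \<omega>))"
    by (simp add: comp_def)
  then show ?thesis
    using int by (intro indep_var_lebesgue_integral)
qed

text \<open>Pythagoras in L2: the square is expanded into a double sum, of which only the diagonal
  survives.\<close>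

lemma
  fixes D :: "'i \<Rightarrow> 'a \<Rightarrow> real"
  assumes fin: "finite I"
    and int: "\<And>j k. j \<in> I \<Longrightarrow> k \<in> I \<Longrightarrow> integrable M (\<lambda>\<omega>. D j \<omega> * D k \<omega>)"
    and orth: "\<And>j k. j \<in> I \<Longrightarrow> k \<in> I \<Longrightarrow> j \<noteq> k \<Longrightarrow> (LINT \<omega>|M. D j \<omega> * D k \<omega>) = 0"
  shows integrable_square_orthogonal_sum: "integrable M (\<lambda>\<omega>. (\<Sum>k\<in>I. w k * D k \<omega>)\<^sup>2)"
    and integral_square_orthogonal_sum:
      "(LINT \<omega>|M. (\<Sum>k\<in>I. w k * D k \<omega>)\<^sup>2) = (\<Sum>k\<in>I. (w k)\<^sup>2 * (LINT \<omega>|M. (D k \<omega>)\<^sup>2))"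
proof -
  have eq: "(\<Sum>k\<in>I. w k * D k \<omega>)\<^sup>2 = (\<Sum>j\<in>I. \<Sum>k\<in>I. w j * w k * (D j \<omega> * D k \<omega>))" for \<omega>
    by (simp add: power2_eq_square sum_product mult_ac)
  show "integrable M (\<lambda>\<omega>. (\<Sum>k\<in>I. w k * D k \<omega>)\<^sup>2)"
    unfolding eq using int by (intro Bochner_Integration.integrable_sum integrable_mult_right) auto
  have "(LINT \<omega>|M. (\<Sum>k\<in>I. w k * D k \<omega>)\<^sup>2)
      = (\<Sum>j\<in>I. \<Sum>k\<in>I. w j * w k * (LINT \<omega>|M. D j \<omega> * D k \<omega>))"
    unfolding eq using int by (simp add: Bochner_Integration.integral_sum)
  also have "\<dots> = (\<Sum>j\<in>I. \<Sum>k\<in>I. if k = j then w j * w k * (LINT \<omega>|M. D j \<omega> * D k \<omega>) else 0)"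
    using orth by (intro sum.cong) auto
  also have "\<dots> = (\<Sum>k\<in>I. (w k)\<^sup>2 * (LINT \<omega>|M. (D k \<omega>)\<^sup>2))"
    using fin by (simp add: power2_eq_square)
  finally show "(LINT \<omega>|M. (\<Sum>k\<in>I. w k * D k \<omega>)\<^sup>2) = (\<Sum>k\<in>I. (w k)\<^sup>2 * (LINT \<omega>|M. (D k \<omega>)\<^sup>2))" .
qed

theorem theorem1:
  fixes X :: "(real ^ 'r) set"
    and M :: "'a measure"
    and obs :: "nat \<Rightarrow> 'a \<Rightarrow> real ^ 'r"
    and g :: "nat \<Rightarrow> real ^ 'r \<Rightarrow> real"
    and glo gup :: "real ^ 'r \<Rightarrow> real"
    and K :: "real ^ 'r \<Rightarrow> real"
    and x :: "real ^ 'r"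
    and \<rho>s \<theta>s :: "nat \<Rightarrow> real"
    and gbar \<delta> Kbar A H \<nu> \<rho> \<theta> z0 :: real
    and z :: "nat \<Rightarrow> 'a \<Rightarrow> real"
  assumes prob: "prob_space M"
    and x_in: "x \<in> X"
    and dens: "\<And>t. prob_density_on X (g t)"
    and obs_indep: "prob_space.indep_vars M (\<lambda>_. borel) obs UNIV"
    and obs_dens: "\<And>t. distributed M lborel (obs t) (\<lambda>y. ennreal (indicat_real X y * g t y))"
    and g_class: "\<And>t. g t \<in> tracked_class X glo gup gbar"
    and \<delta>_pos: "\<delta> > 0"
    and drift: "\<And>t. \<bar>g (Suc t) x - g t x\<bar> \<le> \<delta>"
    and K_dens: "prob_density_on UNIV K"
    and K_bounded: "bounded (range K)"
    and K_mass: "(LINT y:X|lborel. K y) = 1"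
    and K_sup: "\<forall>y\<in>X. K y \<le> Kbar"
    and K_moment: "integrable lborel (\<lambda>y. norm y powr \<nu> * K y)"
    and A_eq: "A = (LINT y|lborel. norm y powr \<nu> * K y)"
    and K_mass_at_x: "(LINT y:X|lborel. window_kernel K \<theta> x y) = 1"
    and \<rho>_const: "\<And>t. \<rho>s t = \<rho>"
    and \<rho>_range: "0 < \<rho>" "\<rho> \<le> 1/2"
    and \<theta>_const: "\<And>t. \<theta>s t = \<theta>"
    and \<theta>_pos: "\<theta> > 0"
    and holder: "globally_holder_at X g H \<nu> x"
    and z0_in: "z0 \<in> {glo x..gup x}"
    and z_sqg: "\<And>t \<omega>. \<omega> \<in> space M \<Longrightarrow>
                  z t \<omega> = sqg (glo x) (gup x) K \<rho>s \<theta>s x z0 (\<lambda>s. obs s \<omega>) t"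
  shows "\<exists>\<zeta> :: nat \<Rightarrow> 'a \<Rightarrow> real. \<forall>t.
           (\<forall>\<omega>\<in>space M.
              (z (Suc t) \<omega> - g (Suc t) x)\<^sup>2 \<le>
                4 * gbar * \<delta> / \<rho> + 2 * gbar * A * H * \<theta> powr \<nu> + gbar\<^sup>2 * \<rho>
                + Kbar\<^sup>2 * \<rho> / \<theta> ^ (2 * CARD('r))
                + (1 - 2 * \<rho>) ^ t * (z0 - g 0 x)\<^sup>2 + \<zeta> t \<omega>)
           \<and> integrable M (\<zeta> t) \<and> prob_space.expectation M (\<zeta> t) = 0
           \<and> integrable M (\<lambda>\<omega>. (\<zeta> t \<omega>)\<^sup>2)
           \<and> prob_space.variance M (\<zeta> t) \<le> 2 * \<rho> * gbar ^ 3 * (gbar + Kbar / \<theta> ^ CARD('r))"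
proof -
  interpret prob_space M by (fact prob)
  have obs_meas [measurable]: "obs t \<in> borel_measurable M" for t
    using distributed_measurable[OF obs_dens[of t]] by simp
  let ?n = "CARD('r)"
  define W where "W = window_kernel K \<theta> x"
  define f where "f t y = indicat_real X y * g t y" for t y
  define \<kappa> where "\<kappa> = Kbar / \<theta> ^ ?n"
  define B where "B = A * H * \<theta> powr \<nu>"
  define m where "m t = expectation (\<lambda>\<omega>. W (obs t \<omega>))" for t
  define q where "q = 1 - 2 * \<rho>"
  define S where "S t \<omega> = sqg (glo x) (gup x) K \<rho>s \<theta>s x z0 (\<lambda>s. obs s \<omega>) t" for t \<omega>
  define D where "D t \<omega> = (S t \<omega> - g t x) * (W (obs t \<omega>) - m t)" for t \<omega>
  define Z where "Z t \<omega> = (\<Sum>k\<le>t. q ^ (t - k) * (2 * \<rho> * D k \<omega>))" for t \<omega>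

  \<comment> \<open>Kernel, window and class bounds at \<open>x\<close>\<close>
  have K_meas [measurable]: "K \<in> borel_measurable borel" and K_int1: "(LINT y|lborel. K y) = 1"
    and K_nn: "0 \<le> K y" for y
    using K_dens by (auto simp: prob_density_on_def set_borel_measurable_def set_lebesgue_integral_def)
  have W_meas [measurable]: "W \<in> borel_measurable borel"
    unfolding W_def by measurable
  have W_eq: "W y = K ((y - x) /\<^sub>R \<theta>) / \<theta> ^ ?n" for y
    by (simp add: W_def window_kernel_def)
  have W_nn: "0 \<le> W y" for y
    using K_nn \<theta>_pos by (simp add: W_eq)
  \<comment> \<open>\<open>C\<close> bounds \<open>K\<close> everywhere, whereas \<open>Kbar\<close>
    does so only on \<open>X\<close>. It serves integrability alone and never enters the final
    constants.\<close>
  obtain C where C: "\<And>y. K y \<le> C"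
    using K_bounded by (auto simp: bounded_iff) (metis abs_le_D1)
  have W_le: "W y \<le> C / \<theta> ^ ?n" for y
    using C \<theta>_pos by (simp add: W_eq divide_right_mono)
  have Kbar_nn: "0 \<le> Kbar"
    using K_nn[of x] K_sup x_in by force
  have \<kappa>_nn: "0 \<le> \<kappa>"
    using Kbar_nn \<theta>_pos by (simp add: \<kappa>_def)
  have G: "0 \<le> glo x" "glo x \<le> g t x" "g t x \<le> gup x" "gup x \<le> gbar" for t
    using g_class[of t] x_in by (auto simp: tracked_class_def)
  have gbar_nn: "0 \<le> gbar"
    using G(1,4) G(2,3)[of 0] by linarith
  have g_bounds: "0 \<le> g t y" "g t y \<le> gbar" if "y \<in> X" for t y
    using g_class[of t] that by (force simp: tracked_class_def)+
  have f_meas [measurable]: "f t \<in> borel_measurable borel" for t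
    using dens[of t] by (simp add: prob_density_on_def set_borel_measurable_def f_def[abs_def])
  have f_nn: "0 \<le> f t y" for t y
    using g_bounds by (simp add: f_def indicator_def)

  \<comment> \<open>Mass of the window on \<open>X\<close> and its almost sure bound\<close>
  have XW_int: "integrable lborel (\<lambda>y. indicat_real X y * W y)"
    and XW_mass: "(LINT y|lborel. indicat_real X y * W y) = 1"
    \<comment> \<open>A nonintegrable function has integral 0 by convention, so mass 1 already
      yields integrability.\<close>
    using K_mass_at_x not_integrable_integral_eq
    by (force simp: set_lebesgue_integral_def W_def)+

  have AE_K: "AE u in lborel. K u \<le> Kbar"
  proof (rule AE_le_if_mass_on)
    show "integrable lborel K"
      using K_int1 not_integrable_integral_eq by force
    show "set_integrable lborel X K"
      using K_mass not_integrable_integral_eq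
      by (force simp: set_lebesgue_integral_def set_integrable_def)
  qed (use K_nn K_mass K_int1 K_sup Kbar_nn in auto)
  have "AE y in lborel. K ((y - x) /\<^sub>R \<theta>) \<le> Kbar"
    by (rule AE_lborel_affine[OF \<theta>_pos _ AE_K]) measurable
  then have AE_W: "AE y in lborel. W y \<le> \<kappa>"
    by eventually_elim (use \<theta>_pos in \<open>simp add: W_eq \<kappa>_def divide_right_mono\<close>)
  have obs_f: "distributed M lborel (obs t) (\<lambda>y. ennreal (f t y))" for t
    using obs_dens[of t] by (simp add: f_def)
  have W_obs: "AE \<omega> in M. W (obs t \<omega>) \<le> \<kappa>" for t
  proof -
    \<comment> \<open>The law of an observation has a Lebesgue density, so Lebesgue null sets are
      null for it too.\<close>
    have "AE y in density lborel (\<lambda>y. ennreal (f t y)). W y \<le> \<kappa>"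
      using AE_W by (subst AE_density) (auto elim: eventually_mono)
    then have "AE y in distr M lborel (obs t). W y \<le> \<kappa>"
      unfolding distributed_distr_eq_density[OF obs_f] .
    then show ?thesis
      by (subst (asm) AE_distr_iff) auto
  qed

  \<comment> \<open>Means of the kernel values\<close>
  have obs_integral: "expectation (\<lambda>\<omega>. h (obs t \<omega>)) = (LINT y|lborel. f t y * h y)"
    if "h \<in> borel_measurable borel" for h t
    using distributed_integral[OF obs_f, of h t] f_nn that by simp
  have m_eq: "m t = (LINT y|lborel. f t y * W y)" for t
    unfolding m_def by (rule obs_integral) measurable
  \<comment> \<open>Integrated, this gives \<open>m t \<le> gbar\<close>, because \<open>W\<close>
    has mass 1 on \<open>X\<close>.\<close>
  have fW_le: "f t y * W y \<le> gbar * (indicat_real X y * W y)" for t y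
    using g_bounds W_nn by (auto simp: f_def indicator_def intro: mult_right_mono)
  have fW_int: "integrable lborel (\<lambda>y. f t y * W y)" for t
    by (rule Bochner_Integration.integrable_bound[OF integrable_mult_right[OF XW_int, of gbar]])
       (use fW_le f_nn W_nn gbar_nn in auto)
  have m_le: "m t \<le> gbar" for t
    using integral_mono[OF fW_int integrable_mult_right[OF XW_int, of gbar] fW_le] XW_mass
    by (simp add: m_eq)

  \<comment> \<open>Bias of the kernel values\<close>
  have moment_int: "integrable lborel (\<lambda>y. norm (y - x) powr \<nu> * W y)"
    and moment: "(LINT y|lborel. norm (y - x) powr \<nu> * W y) = \<theta> powr \<nu> * A"
  proof -
    let ?h = "\<lambda>u. norm u powr \<nu> * K u"
    \<comment> \<open>Homogeneity of the norm pulls out \<open>\<theta> powr \<nu>\<close> and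
      leaves the moment integrand of \<open>K\<close> in the scaled variable.\<close>
    have "norm (y - x) powr \<nu> * W y = \<theta> powr \<nu> * (?h ((y - x) /\<^sub>R \<theta>) / \<theta> ^ ?n)" for y
    proof -
      have "norm (y - x) = \<theta> * norm ((y - x) /\<^sub>R \<theta>)"
        using \<theta>_pos by simp
      then have "norm (y - x) powr \<nu> = \<theta> powr \<nu> * norm ((y - x) /\<^sub>R \<theta>) powr \<nu>"
        using \<theta>_pos by (metis powr_mult)
      then show ?thesis
        by (simp only: W_eq mult.assoc times_divide_eq_right)
    qed
    then have eq: "(\<lambda>y. norm (y - x) powr \<nu> * W y) = (\<lambda>y. \<theta> powr \<nu> * (?h ((y - x) /\<^sub>R \<theta>) / \<theta> ^ DIM(real ^ 'r)))"
      by simp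
    have h [measurable]: "?h \<in> borel_measurable borel"
      by measurable
    show "integrable lborel (\<lambda>y. norm (y - x) powr \<nu> * W y)"
      unfolding eq by (intro integrable_mult_right) (use lborel_integrable_affine[OF \<theta>_pos h] K_moment in blast)
    show "(LINT y|lborel. norm (y - x) powr \<nu> * W y) = \<theta> powr \<nu> * A"
      unfolding eq A_eq integral_mult_right_zero lborel_integral_affine[OF \<theta>_pos h] ..
  qed
  have A_nn: "0 \<le> A"
    unfolding A_eq using K_nn by (intro Bochner_Integration.integral_nonneg) simp
  have hold: "\<bar>g t x - g t y\<bar> \<le> H * norm (y - x) powr \<nu>" if "y \<in> X" for t y
    using holder that unfolding globally_holder_at_def norm_minus_commute[of y x] by blast
  (* X is not contained in {x}, since the kernel has mass 1 on X. *)
  have H_nn: "0 \<le> H"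
  proof (rule ccontr)
    assume "\<not> 0 \<le> H"
    have "y = x" if "y \<in> X" for y
    proof (rule ccontr)
      assume "y \<noteq> x"
      then have "H * norm (y - x) powr \<nu> < 0"
        using \<open>\<not> 0 \<le> H\<close> by (simp add: mult_less_0_iff)
      then show False
        using hold[OF that, of 0] by linarith
    qed
    then have "X = {x}"
      using x_in by blast
    have "AE y in lborel. y \<noteq> x"
      by (rule AE_lborel_singleton)
    then have "AE y in lborel. indicat_real X y * W y = 0"
      by eventually_elim (simp add: \<open>X = {x}\<close>)
    then have "(LINT y|lborel. indicat_real X y * W y) = 0"
      by (rule integral_eq_zero_AE)
    then show False
      using XW_mass by simp
  qed
  have B_nn: "0 \<le> B"
    using A_nn H_nn by (simp add: B_def)

  have bias: "\<bar>m t - g t x\<bar> \<le> B" for t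
  proof -
    \<comment> \<open>Mass 1 of \<open>W\<close> on \<open>X\<close> lets \<open>g t x\<close> be
      moved under the integral, where the Hoelder bound applies pointwise.\<close>
    let ?d = "\<lambda>y. f t y * W y - g t x * (indicat_real X y * W y)"
    have "m t - g t x = (LINT y|lborel. ?d y)"
      using fW_int XW_int XW_mass by (simp add: m_eq)
    also have "\<bar>\<dots>\<bar> \<le> (LINT y|lborel. H * (norm (y - x) powr \<nu> * W y))"
    proof (rule integral_abs_bound[THEN order_trans], rule integral_mono)
      show "integrable lborel (\<lambda>y. \<bar>?d y\<bar>)"
        using fW_int XW_int by (intro integrable_abs Bochner_Integration.integrable_diff integrable_mult_right)
      show "integrable lborel (\<lambda>y. H * (norm (y - x) powr \<nu> * W y))"
        by (intro integrable_mult_right moment_int)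
      fix y :: "real ^ 'r"
      show "\<bar>?d y\<bar> \<le> H * (norm (y - x) powr \<nu> * W y)"
      proof (cases "y \<in> X")
        case True
        then have "?d y = (g t y - g t x) * W y"
          by (simp add: f_def algebra_simps)
        then have "\<bar>?d y\<bar> = \<bar>g t x - g t y\<bar> * W y"
          using W_nn[of y] by (simp add: abs_mult abs_minus_commute)
        also have "\<dots> \<le> (H * norm (y - x) powr \<nu>) * W y"
          using W_nn hold[OF True] by (intro mult_right_mono)
        finally show ?thesis
          by (simp only: mult.assoc)
      \<comment> \<open>Off \<open>X\<close> the left-hand side is 0, so the sign of
        \<open>H\<close> is what matters.\<close>
      qed (use H_nn W_nn in \<open>simp add: f_def\<close>)
    qed
    also have "\<dots> = B"
      unfolding integral_mult_right_zero moment by (simp add: B_def)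
    finally show ?thesis .
  qed

  \<comment> \<open>The estimates as bounded functions of the past\<close>
  have S_bounds: "glo x \<le> S t \<omega>" "S t \<omega> \<le> gup x" for t \<omega>
    unfolding S_def using sqg_bounds[OF z0_in] by blast+
  have S_diff: "\<bar>S t \<omega> - g s x\<bar> \<le> gbar" for t s \<omega>
    using S_bounds[of t \<omega>] G(1,4) G(2,3)[of s] by linarith
  let ?past = "\<lambda>k \<omega>. restrict (\<lambda>s. obs s \<omega>) {..<k}"
  let ?S = "\<lambda>k y. sqg (glo x) (gup x) K \<rho>s \<theta>s x z0 y k"
  \<comment> \<open>The restriction is \<open>undefined\<close> at indices from \<open>k\<close> on,
    but the estimate at time \<open>j \<le> k\<close> never reads those.\<close>
  have S_past: "S j \<omega> = ?S j (?past k \<omega>)" if "j \<le> k" for j k \<omega>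
    unfolding S_def using that by (intro sqg_cong) simp
  have past_meas [measurable]: "?past k \<in> M \<rightarrow>\<^sub>M PiM {..<k} (\<lambda>_. borel)" for k
    by measurable
  have S_meas [measurable]: "S k \<in> borel_measurable M" for k
    using measurable_compose[OF past_meas[of k] measurable_sqg[OF K_meas order_refl]]
    by (simp add: S_past[OF order_refl, abs_def])
  have D_meas [measurable]: "D k \<in> borel_measurable M" for k
    unfolding D_def[abs_def] by measurable

  \<comment> \<open>Noise terms: integrability, centring, orthogonality\<close>
  define c where "c = C / \<theta> ^ ?n + gbar"
  have m_nn: "0 \<le> m t" for t
    unfolding m_def using W_nn by (intro Bochner_Integration.integral_nonneg) simp
  have dev_le: "\<bar>W y - m t\<bar> \<le> c" for y t
    using W_le[of y] W_nn[of y] m_le[of t] m_nn[of t] gbar_nn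
    unfolding c_def by linarith
  have D_le: "\<bar>D t \<omega>\<bar> \<le> gbar * c" for t \<omega>
    unfolding D_def abs_mult using S_diff dev_le gbar_nn by (intro mult_mono) auto
  have DD_int: "integrable M (\<lambda>\<omega>. D j \<omega> * D k \<omega>)" for j k
    by (rule integrable_const_bound[where B = "(gbar * c) * (gbar * c)"])
       (auto simp: abs_mult intro!: AE_I2 mult_mono D_le order_trans[OF abs_ge_zero D_le])
  have D_int: "integrable M (D k)" for k
    by (rule integrable_const_bound[where B = "gbar * c"]) (auto intro: AE_I2 D_le)
  have W_int: "integrable M (\<lambda>\<omega>. W (obs t \<omega>))" for t
    by (rule integrable_const_bound[where B = "C / \<theta> ^ ?n"]) (auto simp: W_nn intro!: AE_I2 W_le)
  have dev_int: "integrable M (\<lambda>\<omega>. W (obs t \<omega>) - m t)" for t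
    using W_int by simp
  have dev_mean: "expectation (\<lambda>\<omega>. W (obs t \<omega>) - m t) = 0" for t
    using W_int by (simp add: m_def prob_space)

  \<comment> \<open>Plays the part of conditioning on the past: a bounded function of earlier
    observations multiplies a centred factor independent of them.\<close>
  have pull_out: "expectation (\<lambda>\<omega>. F (?past k \<omega>) * (W (obs k \<omega>) - m k)) = 0"
    if "F \<in> borel_measurable (PiM {..<k} (\<lambda>_. borel))" "\<And>\<omega>. \<bar>F (?past k \<omega>)\<bar> \<le> b" for F k b
  proof -
    have "integrable M (\<lambda>\<omega>. F (?past k \<omega>))"
      using that measurable_compose[OF past_meas that(1)]
      by (intro integrable_const_bound[where B = b]) auto
    then show ?thesis
      using expectation_past_times_present[OF obs_indep that(1), of "\<lambda>y. W y - m k"] dev_int dev_mean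
      by simp
  qed
  have D_mean: "expectation (D k) = 0" for k
    using pull_out[of "\<lambda>y. ?S k y - g k x" k gbar] measurable_sqg[OF K_meas order_refl] S_diff
    by (simp add: D_def[abs_def] S_past[OF order_refl])
  have D_orth_less: "expectation (\<lambda>\<omega>. D j \<omega> * D k \<omega>) = 0" if "j < k" for j k
  proof -
    \<comment> \<open>In the product only the second factor of \<open>D k\<close> involves
      observation \<open>k\<close>. All the rest, including \<open>W (y j)\<close>, belongs to the
      past because \<open>j < k\<close>.\<close>
    let ?F = "\<lambda>y. (?S j y - g j x) * (W (y j) - m j) * (?S k y - g k x)"
    have eq: "?F (?past k \<omega>) = D j \<omega> * (S k \<omega> - g k x)" for \<omega>
      using that S_past[of j k \<omega>] S_past[of k k \<omega>] by (simp add: D_def)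
    have [measurable]: "?S j \<in> borel_measurable (PiM {..<k} (\<lambda>_. borel))"
        "?S k \<in> borel_measurable (PiM {..<k} (\<lambda>_. borel))"
        "(\<lambda>y. y j) \<in> PiM {..<k} (\<lambda>_. borel) \<rightarrow>\<^sub>M borel"
      using measurable_sqg[OF K_meas] that by simp_all
    have "expectation (\<lambda>\<omega>. ?F (?past k \<omega>) * (W (obs k \<omega>) - m k)) = 0"
    proof (rule pull_out)
      show "?F \<in> borel_measurable (PiM {..<k} (\<lambda>_. borel))"
        by measurable
      show "\<bar>?F (?past k \<omega>)\<bar> \<le> gbar * c * gbar" for \<omega>
        unfolding eq abs_mult
        by (intro mult_mono D_le S_diff order_trans[OF abs_ge_zero D_le]) auto
    qed
    then show ?thesis
      unfolding eq by (simp add: D_def mult.assoc)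
  qed
  have D_orth: "expectation (\<lambda>\<omega>. D j \<omega> * D k \<omega>) = 0" if "j \<noteq> k" for j k
    using D_orth_less[of j k] D_orth_less[of k j] that
    by (cases "j < k") (auto simp: mult.commute)

  \<comment> \<open>Second moment of one noise term\<close>
  have D_sq: "expectation (\<lambda>\<omega>. (D k \<omega>)\<^sup>2) \<le> gbar ^ 3 * \<kappa>" for k
  proof -
    have W2_int: "integrable M (\<lambda>\<omega>. (W (obs k \<omega>))\<^sup>2)"
      by (rule integrable_const_bound[where B = "(C / \<theta> ^ ?n)\<^sup>2"])
         (auto simp: W_nn intro!: AE_I2 power_mono W_le)
    have dev2_int: "integrable M (\<lambda>\<omega>. (W (obs k \<omega>) - m k)\<^sup>2)"
      by (rule integrable_const_bound[where B = "c\<^sup>2"])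
         (auto intro!: AE_I2 simp: power2_le_iff_abs_le order_trans[OF abs_ge_zero dev_le] dev_le)
    \<comment> \<open>The variance is at most the second moment. There one factor \<open>W\<close>
      is bounded by \<open>\<kappa>\<close> almost surely and the other leaves the mean, so
      \<open>\<kappa>\<close> enters linearly rather than squared.\<close>
    have "expectation (\<lambda>\<omega>. (W (obs k \<omega>) - m k)\<^sup>2) \<le> expectation (\<lambda>\<omega>. (W (obs k \<omega>))\<^sup>2)"
      using variance_eq[OF W_int W2_int] by (simp add: m_def)
    also have "\<dots> \<le> expectation (\<lambda>\<omega>. \<kappa> * W (obs k \<omega>))"
    proof (rule integral_mono_AE)
      show "AE \<omega> in M. (W (obs k \<omega>))\<^sup>2 \<le> \<kappa> * W (obs k \<omega>)"
        using W_obs[of k] by eventually_elim (simp add: power2_eq_square W_nn mult_right_mono)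
    qed (use W2_int W_int in auto)
    also have "\<dots> = \<kappa> * m k"
      by (simp add: m_def)
    also have "\<dots> \<le> \<kappa> * gbar"
      using m_le \<kappa>_nn by (intro mult_left_mono)
    finally have dev2: "expectation (\<lambda>\<omega>. (W (obs k \<omega>) - m k)\<^sup>2) \<le> \<kappa> * gbar" .
    have "expectation (\<lambda>\<omega>. (D k \<omega>)\<^sup>2) \<le> expectation (\<lambda>\<omega>. gbar\<^sup>2 * (W (obs k \<omega>) - m k)\<^sup>2)"
    proof (rule integral_mono)
      show "(D k \<omega>)\<^sup>2 \<le> gbar\<^sup>2 * (W (obs k \<omega>) - m k)\<^sup>2" for \<omega>
        unfolding D_def power_mult_distrib using S_diff gbar_nn
        by (intro mult_right_mono) (auto simp: power2_le_iff_abs_le)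
    qed (use DD_int[of k k] dev2_int in \<open>auto simp: power2_eq_square\<close>)
    also have "\<dots> \<le> gbar\<^sup>2 * (\<kappa> * gbar)"
      using dev2 by (simp add: mult_left_mono)
    finally show ?thesis
      by (simp add: power2_eq_square power3_eq_cube mult_ac)
  qed

  \<comment> \<open>Mean and variance of the accumulated noise\<close>
  have q: "0 \<le> q" "q < 1"
    using \<rho>_range by (simp_all add: q_def)
  have geom: "(\<Sum>j\<le>t. q ^ j) \<le> 1 / (2 * \<rho>)" for t
    using sum_power_le[OF q] by (simp add: q_def)

  have Z_eq: "Z t = (\<lambda>\<omega>. \<Sum>k\<in>{..t}. (2 * \<rho> * q ^ (t - k)) * D k \<omega>)" for t
    by (simp add: Z_def[abs_def] mult_ac)
  have Z_int: "integrable M (Z t)" for t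
    unfolding Z_eq using D_int by (intro Bochner_Integration.integrable_sum integrable_mult_right)
  have Z_mean: "expectation (Z t) = 0" for t
    unfolding Z_eq using D_int D_mean by (simp add: Bochner_Integration.integral_sum)
  have Z2_int: "integrable M (\<lambda>\<omega>. (Z t \<omega>)\<^sup>2)" for t
    unfolding Z_eq using DD_int D_orth by (intro integrable_square_orthogonal_sum) auto
  have Z_var: "expectation (\<lambda>\<omega>. (Z t \<omega>)\<^sup>2) \<le> 2 * \<rho> * gbar ^ 3 * (gbar + \<kappa>)" for t
  proof -
    have "expectation (\<lambda>\<omega>. (Z t \<omega>)\<^sup>2)
        = (\<Sum>k\<le>t. (2 * \<rho> * q ^ (t - k))\<^sup>2 * expectation (\<lambda>\<omega>. (D k \<omega>)\<^sup>2))"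
      unfolding Z_eq using DD_int D_orth by (intro integral_square_orthogonal_sum) auto
    also have "\<dots> \<le> (\<Sum>k\<le>t. 4 * \<rho>\<^sup>2 * q ^ (t - k) * (gbar ^ 3 * \<kappa>))"
    proof (intro sum_mono mult_mono)
      fix k
      \<comment> \<open>Replacing squared weights by the weights themselves reduces the sum to the
        geometric series already bounded.\<close>
      have "(q ^ (t - k))\<^sup>2 \<le> q ^ (t - k)"
        using q power_le_one[of q "t - k"] by (simp add: power2_eq_square mult_left_le)
      then show "(2 * \<rho> * q ^ (t - k))\<^sup>2 \<le> 4 * \<rho>\<^sup>2 * q ^ (t - k)"
        by (simp add: power_mult_distrib mult_left_mono)
    qed (use D_sq q in auto)
    also have "\<dots> = 4 * \<rho>\<^sup>2 * (gbar ^ 3 * \<kappa>) * (\<Sum>k\<le>t. q ^ (t - k))"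
      by (simp add: sum_distrib_left mult_ac)
    also have "(\<Sum>k\<le>t. q ^ (t - k)) = (\<Sum>j\<le>t. q ^ j)"
      using sum.nat_diff_reindex[of "(^) q" "Suc t"] by (simp add: lessThan_Suc_atMost)
    also have "4 * \<rho>\<^sup>2 * (gbar ^ 3 * \<kappa>) * (\<Sum>j\<le>t. q ^ j) \<le> 4 * \<rho>\<^sup>2 * (gbar ^ 3 * \<kappa>) * (1 / (2 * \<rho>))"
      using geom gbar_nn \<kappa>_nn by (intro mult_left_mono) auto
    also have "\<dots> = 2 * \<rho> * gbar ^ 3 * \<kappa>"
      using \<rho>_range by (simp add: power2_eq_square)
    \<comment> \<open>The bound just obtained has \<open>\<kappa>\<close> alone; the nonnegative
      summand \<open>gbar\<close> is added to reach the stated form.\<close>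
    also have "\<dots> \<le> 2 * \<rho> * gbar ^ 3 * (gbar + \<kappa>)"
      using \<rho>_range gbar_nn by (intro mult_left_mono) auto
    finally show ?thesis .
  qed

  \<comment> \<open>Pathwise bound where all kernel values are at most
    \<open>\<kappa>\<close>\<close>
  define \<sigma> where "\<sigma> = \<delta> / \<rho>"
  have \<sigma>_nn: "0 \<le> \<sigma>"
    using \<delta>_pos \<rho>_range by (simp add: \<sigma>_def)
  \<comment> \<open>The deterministic part of the claim, grouped into products that the linear
    comparison below treats as atoms; \<open>R_eq\<close> restores the stated form.\<close>
  define R where "R t = 4 * (gbar * \<sigma>) + 2 * (gbar * B) + gbar\<^sup>2 * \<rho> + \<kappa>\<^sup>2 * \<rho>
      + q ^ t * (z0 - g 0 x)\<^sup>2" for t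
  have R_nn: "0 \<le> R t" for t
    unfolding R_def using gbar_nn \<sigma>_nn B_nn \<rho>_range q by (intro add_nonneg_nonneg) auto
  have path: "(S (Suc t) \<omega> - g (Suc t) x)\<^sup>2 \<le> R t + Z t \<omega>"
    if \<omega>: "\<And>k. W (obs k \<omega>) \<le> \<kappa>" for t \<omega>
  proof -
    define \<gamma> where "\<gamma> = 2 * \<rho> * (gbar * B) + \<rho>\<^sup>2 * (gbar\<^sup>2 + \<kappa>\<^sup>2) + 2 * gbar * \<delta>"
    have "(S (Suc t) \<omega> - g (Suc t) x)\<^sup>2 \<le> q * (S t \<omega> - g t x)\<^sup>2 + \<gamma> + 2 * \<rho> * D t \<omega>" for t
    proof -
      have "S (Suc t) \<omega> = min (gup x) (max (glo x) (S t \<omega> - \<rho> * (S t \<omega> - W (obs t \<omega>))))"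
        by (simp add: S_def W_def \<rho>_const \<theta>_const Let_def)
      then show ?thesis
        unfolding D_def q_def \<gamma>_def
        using projected_step_bound[OF S_bounds G(2)[of t] G(3)[of t] G(2)[of "Suc t"] G(3)[of "Suc t"]
            G(1) G(4) W_nn \<omega> bias drift, of \<rho>] \<rho>_range
        by simp
    qed
    from linear_recursion_le[where a = "\<lambda>t. (S t \<omega> - g t x)\<^sup>2", OF q(1) this]
    have "(S (Suc t) \<omega> - g (Suc t) x)\<^sup>2
        \<le> q ^ Suc t * (z0 - g 0 x)\<^sup>2 + \<gamma> * (\<Sum>j\<le>t. q ^ j) + Z t \<omega>"
      by (simp add: Z_def S_def)
    \<comment> \<open>The recursion contracts the initial error \<open>Suc t\<close> times, while
      the claim has the exponent \<open>t\<close>.\<close>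
    moreover have "q ^ Suc t * (z0 - g 0 x)\<^sup>2 \<le> q ^ t * (z0 - g 0 x)\<^sup>2"
      using q by (intro mult_right_mono) (auto simp: mult_left_le_one_le)
    moreover have "\<gamma> * (\<Sum>j\<le>t. q ^ j) \<le> gbar * B + gbar\<^sup>2 * \<rho> / 2 + \<kappa>\<^sup>2 * \<rho> / 2 + gbar * \<sigma>"
    proof -
      have "\<gamma> * (\<Sum>j\<le>t. q ^ j) \<le> \<gamma> * (1 / (2 * \<rho>))"
        unfolding \<gamma>_def using geom gbar_nn B_nn \<delta>_pos \<rho>_range by (intro mult_left_mono) auto
      also have "\<dots> = gbar * B + gbar\<^sup>2 * \<rho> / 2 + \<kappa>\<^sup>2 * \<rho> / 2 + gbar * \<sigma>"
        using \<rho>_range by (simp add: \<gamma>_def \<sigma>_def field_simps power2_eq_square)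
      finally show ?thesis .
    qed
    \<comment> \<open>The geometric sum yields one half of each coefficient in \<open>R\<close>, and
      one quarter for \<open>gbar * \<sigma>\<close>. Nonnegativity of the four terms closes the
      gap.\<close>
    moreover have "0 \<le> gbar * B" "0 \<le> gbar\<^sup>2 * \<rho>" "0 \<le> \<kappa>\<^sup>2 * \<rho>" "0 \<le> gbar * \<sigma>"
      using gbar_nn B_nn \<sigma>_nn \<rho>_range by auto
    ultimately show ?thesis
      unfolding R_def by linarith
  qed

  (* K may exceed Kbar off X, so an observation can violate the bound on a null set;
     there the noise is replaced by a constant dominating the squared error. *)
  define N where "N = {\<omega> \<in> space M. \<exists>k. \<kappa> < W (obs k \<omega>)}"
  define \<zeta> where "\<zeta> t \<omega> = (if \<omega> \<in> N then gbar\<^sup>2 else Z t \<omega>)" for t \<omega>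
  have N_meas [measurable]: "N \<in> sets M"
    unfolding N_def by measurable
  have Z_meas [measurable]: "Z t \<in> borel_measurable M" for t
    using Z_int by auto
  have \<zeta>_meas [measurable]: "\<zeta> t \<in> borel_measurable M" for t
    unfolding \<zeta>_def[abs_def] by measurable

  \<comment> \<open>Moments of the modified noise\<close>
  have "AE \<omega> in M. \<forall>k. W (obs k \<omega>) \<le> \<kappa>"
    using W_obs by (simp add: AE_all_countable)
  \<comment> \<open>\<open>N\<close> is a countable union of null events, so the modification
    changes neither moments nor integrability.\<close>
  then have ae: "AE \<omega> in M. \<zeta> t \<omega> = Z t \<omega>" for t
    by eventually_elim (auto simp: \<zeta>_def N_def dest: leD)
  have ae2: "AE \<omega> in M. (\<zeta> t \<omega>)\<^sup>2 = (Z t \<omega>)\<^sup>2" for t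
    using ae[of t] by eventually_elim simp
  have \<zeta>_int: "integrable M (\<zeta> t)" for t
    using Z_int integrable_cong_AE[OF \<zeta>_meas Z_meas ae] by blast
  have \<zeta>_mean: "expectation (\<zeta> t) = 0" for t
    using Z_mean integral_cong_AE[OF \<zeta>_meas Z_meas ae] by simp
  have \<zeta>2_int: "integrable M (\<lambda>\<omega>. (\<zeta> t \<omega>)\<^sup>2)" for t
    using Z2_int integrable_cong_AE[OF _ _ ae2, of t] by simp
  have \<zeta>_var: "variance (\<zeta> t) \<le> 2 * \<rho> * gbar ^ 3 * (gbar + \<kappa>)" for t
    using Z_var[of t] integral_cong_AE[OF _ _ ae2, of t] by (simp add: \<zeta>_mean)
  have err: "(z (Suc t) \<omega> - g (Suc t) x)\<^sup>2 \<le> R t + \<zeta> t \<omega>" if "\<omega> \<in> space M" for t \<omega>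
  proof (cases "\<omega> \<in> N")
    case True
    have "(S (Suc t) \<omega> - g (Suc t) x)\<^sup>2 \<le> gbar\<^sup>2"
      using S_diff gbar_nn by (simp add: power2_le_iff_abs_le)
    then show ?thesis
      using True R_nn[of t] that by (simp add: \<zeta>_def z_sqg S_def del: sqg.simps)
  next
    case False
    then have "W (obs k \<omega>) \<le> \<kappa>" for k
      using that by (auto simp: N_def not_less)
    then show ?thesis
      using False path[of \<omega> t] that by (simp add: \<zeta>_def z_sqg S_def del: sqg.simps)
  qed
  have R_eq: "R t = 4 * gbar * \<delta> / \<rho> + 2 * gbar * A * H * \<theta> powr \<nu> + gbar\<^sup>2 * \<rho>
      + Kbar\<^sup>2 * \<rho> / \<theta> ^ (2 * CARD('r)) + (1 - 2 * \<rho>) ^ t * (z0 - g 0 x)\<^sup>2" for t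
    by (simp add: R_def \<sigma>_def B_def \<kappa>_def q_def power_divide power_mult[symmetric] mult.assoc mult.commute[of 2])
  show ?thesis
    using err \<zeta>_int \<zeta>_mean \<zeta>2_int \<zeta>_var unfolding R_eq \<kappa>_def
    by (intro exI[of _ \<zeta>]) auto
qed

end
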